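(* Let $B=F(b_1,\ldots,b_n)$ be a Ferrers board with $0\le b_1\le\cdots\le b_n$ and $b_n>0$, and let $B^-=F(b_1,\ldots,b_{n-1})$. Then for all $1\le k\le n$, $$\mathbf{FT}_k(B,q)=q^{F_{b_n}}\mathbf{FT}_k(B^-,q)+[F_{b_n}]_q\,\mathbf{FT}_{k-1}(B^-,q)$$ and $$\overline{\mathbf{FT}}_k(B,q)=\overline{\mathbf{FT}}_k(B^-,q)+[F_{b_n}]_q\,\overline{\mathbf{FT}}_{k-1}(B^-,q).$$
   Context: Fibonacci numbers: $F_0=0$, $F_1=1$, $F_m=F_{m-1}+F_{m-2}$. For an integer $m$, $[m]_q=\frac{1-q^m}{1-q}$. For $m\ge1$, $\mathcal{F}_m$ is the set of tilings of a column of height $m$ (levels $1,\dots,m$ from the bottom) by tiles of heights 1 and 2 whose bottom-most tile has height 1; $\mathcal{F}_0=\emptyset$. For $T\in\mathcal{F}_m$, $\mathrm{rank}_m(T)=\sum F_{i-1}$, the sum over all $i$ such that $T$ has a tile of height 2 occupying levels $i-1$ and $i$. A Ferrers board $F(b_1,\dots,b_n)$ has columns $1,\dots,n$ of heights $b_1\le\cdots\le b_n$. For $0\le k\le n$, $\mathcal{FT}_k(B)$ is the set of Fibonacci file placements: a set $I$ of $k$ columns together with, for each $i\in I$, a tiling $T_i\in\mathcal{F}_{b_i}$ (for $k<0$ or $k>n$ the set is empty; for $k=0$ it contains only the empty placement). For such $P$, $w_{B,q}(P)=q^{\sum_{i\in I}\mathrm{rank}_{b_i}(T_i)+\sum_{j\notin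 I}F_{b_j}}$ and $\overline{w}_{B,q}(P)=q^{\sum_{i\in I}\mathrm{rank}_{b_i}(T_i)}$. Then $\mathbf{FT}_k(B,q)=\sum_{P\in\mathcal{FT}_k(B)}w_{B,q}(P)$ and $\overline{\mathbf{FT}}_k(B,q)=\sum_{P\in\mathcal{FT}_k(B)}\overline{w}_{B,q}(P)$. *)

theory Defs
  imports Complex_Main "HOL-Number_Theory.Fib" "HOL-Library.FuncSet"
begin

definition qint :: "'a::field \<Rightarrow> int \<Rightarrow> 'a" where
  "qint q m = (1 - q powi m) / (1 - q)"

text \<open>A tiling of a column is the list of its tile heights, read from the bottom upwards.
  For \<open>m = 0\<close> the set is empty, since the only list with sum 0 has no bottom tile.\<close>

definition fib_tilings :: "nat \<Rightarrow> nat list set" where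
  "fib_tilings m = {T. set T \<subseteq> {1, 2} \<and> sum_list T = m \<and> T \<noteq> [] \<and> hd T = 1}"

text \<open>The tile with list index \<open>j\<close> has its top at level \<open>sum_list (take (Suc j) T)\<close>, so
  a tile of height 2 occupies that level \<open>i\<close> and the level \<open>i - 1\<close>.\<close>

definition domino_tops :: "nat list \<Rightarrow> nat set" where
  "domino_tops T = {i. \<exists>j < length T. T ! j = 2 \<and> sum_list (take (Suc j) T) = i}"

definition tiling_rank :: "nat list \<Rightarrow> nat" where
  "tiling_rank T = (\<Sum>i\<in>domino_tops T. fib (i - 1))"

text \<open>The board \<open>F(b\<^sub>1, \<dots>, b\<^sub>n)\<close> is the list \<open>[b\<^sub>1, \<dots>, b\<^sub>n]\<close>, so column \<open>i\<close> of the board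
  has list index \<open>i - 1\<close>. A placement is a pair of a column set and an (extensional) family
  of tilings indexed by it.\<close>

definition fib_file_placements :: "nat \<Rightarrow> nat list \<Rightarrow> (nat set \<times> (nat \<Rightarrow> nat list)) set" where
  "fib_file_placements k B =
     (SIGMA I : {I. I \<subseteq> {..<length B} \<and> card I = k}. \<Pi>\<^sub>E i\<in>I. fib_tilings (B ! i))"

definition placement_weight ::
  "nat list \<Rightarrow> 'a::comm_semiring_1 \<Rightarrow> nat set \<times> (nat \<Rightarrow> nat list) \<Rightarrow> 'a" where
  "placement_weight B q P =
     (case P of (I, T) \<Rightarrow>
        q ^ ((\<Sum>i\<in>I. tiling_rank (T i)) + (\<Sum>j\<in>{..<length B} - I. fib (B ! j))))"

definition placement_weight_bar ::
  "'a::comm_semiring_1 \<Rightarrow> nat set \<times> (nat \<Rightarrow> nat list) \<Rightarrow> 'a" where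
  "placement_weight_bar q P = (case P of (I, T) \<Rightarrow> q ^ (\<Sum>i\<in>I. tiling_rank (T i)))"

definition FT :: "nat \<Rightarrow> nat list \<Rightarrow> 'a::comm_semiring_1 \<Rightarrow> 'a" where
  "FT k B q = (\<Sum>P\<in>fib_file_placements k B. placement_weight B q P)"

definition FT_bar :: "nat \<Rightarrow> nat list \<Rightarrow> 'a::comm_semiring_1 \<Rightarrow> 'a" where
  "FT_bar k B q = (\<Sum>P\<in>fib_file_placements k B. placement_weight_bar q P)"

lemma finite_fib_tilings: "finite (fib_tilings m)"
proof -
  have "length T \<le> sum_list T" if "set T \<subseteq> {1, 2}" for T :: "nat list"
    using that by (induction T) auto
  then have "fib_tilings m \<subseteq> {T. set T \<subseteq> {1, 2} \<and> length T \<le> m}"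
    by (auto simp: fib_tilings_def)
  then show ?thesis
    by (rule finite_subset) (simp add: finite_lists_length_le)
qed

lemma finite_fib_file_placements: "finite (fib_file_placements k B)"
proof -
  have "finite {I. I \<subseteq> {..<length B} \<and> card I = k}"
    by (rule finite_subset[of _ "Pow {..<length B}"]) auto
  then show ?thesis
    unfolding fib_file_placements_def
    by (rule finite_SigmaI) (auto intro!: finite_PiE finite_fib_tilings intro: finite_subset)
qed

end

theory Submission
  imports Defs "HOL-Computational_Algebra.Polynomial"
begin

text \<open>The placements of all sizes together are enumerated by the product of linear polynomials
  \<open>\<Sum>\<^sub>k FT\<^sub>k(B, q) x\<^sup>k = \<Prod>\<^bsub>b\<in>B\<^esub> (q ^ F\<^sub>b + [F\<^sub>b]\<^sub>q x)\<close>, with constant terms 1 for the other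
  weight: a column is either left empty or filled by one of its tilings. The recurrences compare
  coefficients after splitting off the last factor. The coefficient \<open>[F\<^sub>b]\<^sub>q\<close> arises because the
  rank is a bijection from the tilings of height \<open>b\<close> onto \<open>{0, \<dots>, F\<^sub>b - 1}\<close>: appending a tile of
  height 1 to a tiling of height \<open>m + 1\<close> preserves the rank, while appending one of height 2 to a
  tiling of height \<open>m\<close> raises it by \<open>F\<^bsub>m+1\<^esub>\<close>.\<close>

lemma domino_tops_snoc:
  "domino_tops (T @ [a]) =
     (if a = 2 then insert (sum_list T + 2) (domino_tops T) else domino_tops T)"
proof -
  have "i \<in> domino_tops (T @ [a]) \<longleftrightarrow> (a = 2 \<and> i = sum_list T + 2) \<or> i \<in> domino_tops T" for i
    unfolding domino_tops_def
    by (simp add: Ex_less_Suc nth_append cong: conj_cong) metis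
  then show ?thesis
    by (simp add: set_eq_iff)
qed

lemma domino_tops_le:
  assumes "i \<in> domino_tops T"
  shows "i \<le> sum_list T"
proof -
  from assms obtain j where "sum_list (take (Suc j) T) = i"
    by (auto simp: domino_tops_def)
  moreover have "sum_list T = sum_list (take (Suc j) T) + sum_list (drop (Suc j) T)"
    by (metis append_take_drop_id sum_list_append)
  ultimately show ?thesis by simp
qed

lemma finite_domino_tops: "finite (domino_tops T)"
  by (rule finite_subset[of _ "{..sum_list T}"]) (auto dest: domino_tops_le)

lemma tiling_rank_snoc:
  "tiling_rank (T @ [a]) = tiling_rank T + (if a = 2 then fib (Suc (sum_list T)) else 0)"
proof -
  have "sum_list T + 2 \<notin> domino_tops T"
    using domino_tops_le by fastforce
  then show ?thesis
    by (simp add: tiling_rank_def domino_tops_snoc finite_domino_tops)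
qed

lemma fib_tilings_0: "fib_tilings 0 = {}"
  by (auto simp: fib_tilings_def neq_Nil_conv)

lemma fib_tilings_1: "fib_tilings (Suc 0) = {[1]}"
proof -
  have "T = []" if "set T \<subseteq> {1, 2}" "sum_list T = 0" for T :: "nat list"
    using that by (cases T) auto
  then show ?thesis
    by (auto simp: fib_tilings_def neq_Nil_conv)
qed

lemma fib_tilings_Suc_Suc:
  "fib_tilings (Suc (Suc m)) =
     (\<lambda>T. T @ [1]) ` fib_tilings (Suc m) \<union> (\<lambda>T. T @ [2]) ` fib_tilings m"
proof (intro equalityI subsetI)
  fix T
  assume tiling: "T \<in> fib_tilings (Suc (Suc m))"
  then obtain U a where snoc: "T = U @ [a]"
    by (cases T rule: rev_cases) (auto simp: fib_tilings_def)
  have "U \<noteq> []"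
    using tiling by (auto simp: fib_tilings_def snoc)
  then show "T \<in> (\<lambda>T. T @ [1]) ` fib_tilings (Suc m) \<union> (\<lambda>T. T @ [2]) ` fib_tilings m"
    using tiling by (auto simp: fib_tilings_def snoc)
qed (auto simp: fib_tilings_def)

lemma bij_betw_tiling_rank: "bij_betw tiling_rank (fib_tilings m) {..<fib m}"
proof (induction m rule: fib.induct)
  case 1
  show ?case by (simp add: fib_tilings_0 bij_betw_def)
next
  case 2
  have "tiling_rank [1] = 0"
    by (simp add: tiling_rank_def domino_tops_def)
  then show ?case by (simp add: fib_tilings_1 bij_betw_def lessThan_Suc)
next
  case (3 m)
  have snoc: "bij_betw (\<lambda>T. T @ [a]) A ((\<lambda>T. T @ [a]) ` A)" for a :: nat and A
    by (simp add: bij_betw_def inj_on_def)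
  have single: "bij_betw tiling_rank ((\<lambda>T. T @ [1]) ` fib_tilings (Suc m)) {..<fib (Suc m)}"
    using "3.IH"(1) by (simp add: bij_betw_comp_iff[OF snoc] o_def tiling_rank_snoc)
  have "bij_betw ((+) (fib (Suc m)) \<circ> tiling_rank) (fib_tilings m)
      {fib (Suc m)..<fib (Suc (Suc m))}"
    using "3.IH"(2) by (rule bij_betw_trans) (simp add: lessThan_atLeast0 add.commute)
  moreover have "(tiling_rank \<circ> (\<lambda>T. T @ [2])) T = ((+) (fib (Suc m)) \<circ> tiling_rank) T"
    if "T \<in> fib_tilings m" for T
    using that by (simp add: tiling_rank_snoc fib_tilings_def)
  ultimately have double: "bij_betw tiling_rank ((\<lambda>T. T @ [2]) ` fib_tilings m)
      {fib (Suc m)..<fib (Suc (Suc m))}"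
    unfolding bij_betw_comp_iff[OF snoc] by (simp cong: bij_betw_cong)
  have "{..<fib (Suc m)} \<inter> {fib (Suc m)..<fib (Suc (Suc m))} = {}"
    by auto
  then have "bij_betw tiling_rank (fib_tilings (Suc (Suc m)))
      ({..<fib (Suc m)} \<union> {fib (Suc m)..<fib (Suc (Suc m))})"
    unfolding fib_tilings_Suc_Suc by (rule bij_betw_combine[OF single double])
  then show ?case
    by (simp add: ivl_disj_un_one)
qed

lemma sum_power_tiling_rank:
  fixes q :: "'a::comm_semiring_1"
  shows "(\<Sum>T\<in>fib_tilings m. q ^ tiling_rank T) = (\<Sum>i<fib m. q ^ i)"
  by (rule sum.reindex_bij_betw[OF bij_betw_tiling_rank])

lemma coeff_prod_linear:
  fixes a c :: "'i \<Rightarrow> 'a::comm_semiring_1"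
  assumes "finite A"
  shows "coeff (\<Prod>i\<in>A. [:c i, a i:]) k =
    (\<Sum>I | I \<subseteq> A \<and> card I = k. (\<Prod>i\<in>I. a i) * (\<Prod>j\<in>A - I. c j))"
proof -
  have monomials: "(\<Prod>i\<in>I. monom (a i) (Suc 0)) = monom (\<Prod>i\<in>I. a i) (card I)" for I
    by (induction I rule: infinite_finite_induct) (simp_all add: mult_monom)
  have "(\<Prod>i\<in>A. [:c i, a i:]) = (\<Prod>i\<in>A. monom (a i) (Suc 0) + [:c i:])"
    by (simp add: monom_Suc monom_0)
  also have "\<dots> = (\<Sum>I\<in>Pow A. monom ((\<Prod>i\<in>I. a i) * (\<Prod>j\<in>A - I. c j)) (card I))"
    by (simp add: prod_add[OF assms] monomials prod_to_poly smult_monom mult.commute)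
  finally have "coeff (\<Prod>i\<in>A. [:c i, a i:]) k =
      (\<Sum>I\<in>Pow A. if card I = k then (\<Prod>i\<in>I. a i) * (\<Prod>j\<in>A - I. c j) else 0)"
    by (simp add: coeff_sum)
  also have "\<dots> = (\<Sum>I | I \<subseteq> A \<and> card I = k. (\<Prod>i\<in>I. a i) * (\<Prod>j\<in>A - I. c j))"
    using assms by (simp add: Pow_def flip: sum.inter_filter)
  finally show ?thesis .
qed

lemma sum_Sigma_PiE_prod:
  fixes w :: "'i \<Rightarrow> 't \<Rightarrow> 'a::comm_semiring_1"
  assumes "finite S" and "\<And>I. I \<in> S \<Longrightarrow> finite I"
    and "\<And>I i. I \<in> S \<Longrightarrow> i \<in> I \<Longrightarrow> finite (F i)"
  shows "(\<Sum>(I, T)\<in>(SIGMA I:S. \<Pi>\<^sub>E i\<in>I. F i). (\<Prod>i\<in>I. w i (T i)) * v I) =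
    (\<Sum>I\<in>S. (\<Prod>i\<in>I. \<Sum>t\<in>F i. w i t) * v I)"
proof -
  have "(\<Sum>(I, T)\<in>(SIGMA I:S. \<Pi>\<^sub>E i\<in>I. F i). (\<Prod>i\<in>I. w i (T i)) * v I) =
      (\<Sum>I\<in>S. \<Sum>T\<in>(\<Pi>\<^sub>E i\<in>I. F i). (\<Prod>i\<in>I. w i (T i)) * v I)"
    using assms by (subst sum.Sigma) (auto intro: finite_PiE)
  also have "\<dots> = (\<Sum>I\<in>S. (\<Prod>i\<in>I. \<Sum>t\<in>F i. w i t) * v I)"
    using assms by (simp add: prod_sum_PiE sum_distrib_right)
  finally show ?thesis .
qed

lemma sum_fib_file_placements_eq_coeff:
  fixes q :: "'a::comm_semiring_1"
  shows "(\<Sum>(I, T)\<in>fib_file_placements k B.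
      (\<Prod>i\<in>I. q ^ tiling_rank (T i)) * (\<Prod>j\<in>{..<length B} - I. c (B ! j))) =
    coeff (\<Prod>b\<leftarrow>B. [:c b, \<Sum>i<fib b. q ^ i:]) k"
proof -
  let ?S = "{I. I \<subseteq> {..<length B} \<and> card I = k}"
  have "(\<Sum>(I, T)\<in>fib_file_placements k B.
      (\<Prod>i\<in>I. q ^ tiling_rank (T i)) * (\<Prod>j\<in>{..<length B} - I. c (B ! j))) =
    (\<Sum>I\<in>?S. (\<Prod>i\<in>I. \<Sum>t\<in>fib_tilings (B ! i). q ^ tiling_rank t) *
      (\<Prod>j\<in>{..<length B} - I. c (B ! j)))"
    unfolding fib_file_placements_def
    by (rule sum_Sigma_PiE_prod) (auto intro: finite_fib_tilings finite_subset)
  also have "\<dots> = coeff (\<Prod>i<length B. [:c (B ! i), \<Sum>j<fib (B ! i). q ^ j:]) k"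
    by (simp add: coeff_prod_linear sum_power_tiling_rank)
  finally show ?thesis
    by (simp add: prod.list_conv_set_nth atLeast0LessThan)
qed

lemma FT_eq_coeff: "FT k B q = coeff (\<Prod>b\<leftarrow>B. [:q ^ fib b, \<Sum>i<fib b. q ^ i:]) k"
  by (simp add: FT_def placement_weight_def power_add power_sum
      flip: sum_fib_file_placements_eq_coeff)

lemma FT_bar_eq_coeff: "FT_bar k B q = coeff (\<Prod>b\<leftarrow>B. [:1, \<Sum>i<fib b. q ^ i:]) k"
  by (simp add: FT_bar_def placement_weight_bar_def power_sum
      flip: sum_fib_file_placements_eq_coeff)

lemma FT_Suc_snoc:
  "FT (Suc k) (B @ [b]) q = q ^ fib b * FT (Suc k) B q + (\<Sum>i<fib b. q ^ i) * FT k B q"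
  by (simp add: FT_eq_coeff)

lemma FT_bar_Suc_snoc:
  "FT_bar (Suc k) (B @ [b]) q = FT_bar (Suc k) B q + (\<Sum>i<fib b. q ^ i) * FT_bar k B q"
  by (simp add: FT_bar_eq_coeff)

lemma qint_of_nat: "q \<noteq> 1 \<Longrightarrow> qint q (int m) = (\<Sum>i<m. q ^ i)"
  by (simp add: qint_def sum_gp_strict)

theorem theorem3:
  fixes B :: "nat list" and k :: nat and q :: "'a::field"
  assumes "sorted B" and "B \<noteq> []" and "last B > 0"
    and "1 \<le> k" and "k \<le> length B"
    and "q \<noteq> 1"
  shows "FT k B q =
           q ^ fib (last B) * FT k (butlast B) q
           + qint q (int (fib (last B))) * FT (k - 1) (butlast B) q \<and>
         FT_bar k B q =
           FT_bar k (butlast B) q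
           + qint q (int (fib (last B))) * FT_bar (k - 1) (butlast B) q"
proof -
  obtain C b where "B = C @ [b]"
    using \<open>B \<noteq> []\<close> by (cases B rule: rev_cases) auto
  moreover obtain l where "k = Suc l"
    using \<open>1 \<le> k\<close> by (cases k) auto
  ultimately show ?thesis
    using \<open>q \<noteq> 1\<close> by (simp add: FT_Suc_snoc FT_bar_Suc_snoc qint_of_nat)
qed

end
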